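(* Let $A, B, X$ be $n\times n$ complex matrices such that $A$ and $B$ are positive definite, let $|||\cdot|||$ be a unitarily invariant norm on the $n\times n$ complex matrices, and let $m\in\{1,2,\dots\}$, $0<\nu\leq\frac12$, $r_0=\min\{2\nu,1-2\nu\}$. Then $$\left((1-\nu)|||AX|||+\nu|||XB|||\right)^{m}\geq|||A^{1-\nu}XB^{\nu}|||^{m}+\nu^{m}\left(|||AX|||+|||XB|||\right)^{m}-\left(2\nu\left(|||AX|||\,|||XB|||\right)^{\frac12}-r_{0}\left(\left(|||AX|||\,|||XB|||\right)^{\frac14}-|||AX|||^{\frac12}\right)^{2}\right)^{m}.$$
   Context: A norm $|||\cdot|||$ on the $n\times n$ complex matrices is unitarily invariant if $|||UTV|||=|||T|||$ for all matrices $T$ and all unitary matrices $U,V$. Real powers of positive definite matrices are defined by the spectral functional calculus. *)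

theory Defs
  imports "HOL-Analysis.Analysis"
begin

definition conj_transpose :: "complex^'n^'m \<Rightarrow> complex^'m^'n" where
  "conj_transpose A = map_matrix cnj (transpose A)"

definition unitary_matrix :: "complex^'n^'n \<Rightarrow> bool" where
  "unitary_matrix U \<longleftrightarrow> conj_transpose U ** U = mat 1 \<and> U ** conj_transpose U = mat 1"

(* For Hermitian A the quadratic form is real-valued, so taking Re loses nothing. *)
definition positive_definite :: "complex^'n^'n \<Rightarrow> bool" where
  "positive_definite A \<longleftrightarrow>
     conj_transpose A = A \<and>
     (\<forall>x. x \<noteq> 0 \<longrightarrow> 0 < Re (\<Sum>i\<in>UNIV. cnj (x $ i) * (A *v x) $ i))"

definition diag_matrix :: "('n \<Rightarrow> real) \<Rightarrow> complex^'n^'n" where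
  "diag_matrix d = (\<chi> i j. if i = j then complex_of_real (d i) else 0)"

(* Meaningful for Hermitian A only: f(A) = U diag(f(d)) U* whenever A = U diag(d) U* with U unitary
   and d real. Such a diagonalization exists by the spectral theorem, and f(A) does not depend on
   the one chosen (spectral_calculus_eq below). *)
definition spectral_calculus :: "(real \<Rightarrow> real) \<Rightarrow> complex^'n^'n \<Rightarrow> complex^'n^'n" where
  "spectral_calculus f A = (THE F. \<exists>U d. unitary_matrix U \<and>
     A = U ** diag_matrix d ** conj_transpose U \<and>
     F = U ** diag_matrix (\<lambda>i. f (d i)) ** conj_transpose U)"

definition matrix_powr :: "complex^'n^'n \<Rightarrow> real \<Rightarrow> complex^'n^'n" where
  "matrix_powr A t = spectral_calculus (\<lambda>x. x powr t) A"

definition matrix_norm :: "(complex^'n^'n \<Rightarrow> real) \<Rightarrow> bool" where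
  "matrix_norm N \<longleftrightarrow>
     (\<forall>T. 0 \<le> N T) \<and>
     (\<forall>T. N T = 0 \<longleftrightarrow> T = 0) \<and>
     (\<forall>c T. N (map_matrix (\<lambda>z. c * z) T) = cmod c * N T) \<and>
     (\<forall>S T. N (S + T) \<le> N S + N T)"

definition unitarily_invariant_norm :: "(complex^'n^'n \<Rightarrow> real) \<Rightarrow> bool" where
  "unitarily_invariant_norm N \<longleftrightarrow>
     matrix_norm N \<and>
     (\<forall>T U V. unitary_matrix U \<longrightarrow> unitary_matrix V \<longrightarrow> N (U ** T ** V) = N T)"

lemma diag_matrix_mult_left: "(diag_matrix d ** M) $ i $ j = complex_of_real (d i) * M $ i $ j"
  by (simp add: diag_matrix_def matrix_matrix_mult_def if_distrib[of "\<lambda>x. x * _"] cong: if_cong)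

lemma diag_matrix_mult_right: "(M ** diag_matrix d) $ i $ j = M $ i $ j * complex_of_real (d j)"
  by (simp add: diag_matrix_def matrix_matrix_mult_def if_distrib[of "\<lambda>x. _ * x"] cong: if_cong)

lemma spectral_calculus_unique:
  assumes U: "unitary_matrix U" and V: "unitary_matrix V"
    and eq: "U ** diag_matrix d ** conj_transpose U = V ** diag_matrix e ** conj_transpose V"
  shows "U ** diag_matrix (\<lambda>i. f (d i)) ** conj_transpose U =
         V ** diag_matrix (\<lambda>i. f (e i)) ** conj_transpose V"
proof -
  define W where "W = conj_transpose V ** U"
  have uU: "conj_transpose U ** U = mat 1" "U ** conj_transpose U = mat 1"
    and uV: "conj_transpose V ** V = mat 1" "V ** conj_transpose V = mat 1"
    using U V by (auto simp: unitary_matrix_def)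
  have "W ** diag_matrix d =
      conj_transpose V ** (U ** diag_matrix d ** conj_transpose U) ** U"
    by (metis W_def matrix_mul_assoc matrix_mul_rid uU(1))
  also have "\<dots> = diag_matrix e ** W"
    by (metis eq W_def matrix_mul_assoc matrix_mul_lid uV(1))
  finally have W: "W ** diag_matrix d = diag_matrix e ** W" .
  have "W $ i $ j * complex_of_real (f (d j)) = complex_of_real (f (e i)) * W $ i $ j" for i j
  proof -
    have "W $ i $ j * complex_of_real (d j) = complex_of_real (e i) * W $ i $ j"
      using W by (metis diag_matrix_mult_left diag_matrix_mult_right)
    then show ?thesis by (cases "W $ i $ j = 0") auto
  qed
  then have fW: "W ** diag_matrix (\<lambda>i. f (d i)) = diag_matrix (\<lambda>i. f (e i)) ** W"
    by (simp add: vec_eq_iff diag_matrix_mult_left diag_matrix_mult_right)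
  have "U ** diag_matrix (\<lambda>i. f (d i)) ** conj_transpose U =
      V ** (W ** diag_matrix (\<lambda>i. f (d i))) ** conj_transpose U"
    by (metis W_def matrix_mul_assoc matrix_mul_lid uV(2))
  also have "\<dots> = V ** diag_matrix (\<lambda>i. f (e i)) ** conj_transpose V"
    by (metis fW W_def matrix_mul_assoc matrix_mul_rid uU(2))
  finally show ?thesis .
qed

lemma spectral_calculus_eq:
  assumes "unitary_matrix U" "A = U ** diag_matrix d ** conj_transpose U"
  shows "spectral_calculus f A = U ** diag_matrix (\<lambda>i. f (d i)) ** conj_transpose U"
  unfolding spectral_calculus_def
proof (rule the_equality)
  show "\<exists>U' d'. unitary_matrix U' \<and> A = U' ** diag_matrix d' ** conj_transpose U' \<and>
      U ** diag_matrix (\<lambda>i. f (d i)) ** conj_transpose U =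
      U' ** diag_matrix (\<lambda>i. f (d' i)) ** conj_transpose U'"
    using assms by blast
next
  fix F
  assume "\<exists>U' d'. unitary_matrix U' \<and> A = U' ** diag_matrix d' ** conj_transpose U' \<and>
      F = U' ** diag_matrix (\<lambda>i. f (d' i)) ** conj_transpose U'"
  then show "F = U ** diag_matrix (\<lambda>i. f (d i)) ** conj_transpose U"
    using assms spectral_calculus_unique by metis
qed

end

theory Submission
  imports Defs "HOL-Real_Asymp.Real_Asymp"
begin

text \<open>
  Write \<open>a = N (A ** X)\<close> and \<open>b = N (X ** B)\<close>. The matrices enter only through the interpolation
  inequality \<open>N (A\<^sup>1\<^sup>-\<^sup>\<nu> X B\<^sup>\<nu>) \<le> a\<^sup>1\<^sup>-\<^sup>\<nu> b\<^sup>\<nu>\<close> (\<open>norm_powr_interpolation\<close>); what remains is a statement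
  about real numbers.

  Interpolation. Diagonalizing \<open>A\<close> and \<open>B\<close> and using unitary invariance, one may take them diagonal
  with positive entries \<open>d i\<close> and \<open>e j\<close>. The path \<open>G s\<close> with entries
  \<open>(d i)\<^sup>1\<^sup>-\<^sup>s Y\<^sub>i\<^sub>j (e j)\<^sup>s = d i Y\<^sub>i\<^sub>j exp (s w\<^sub>i\<^sub>j)\<close> joins \<open>D Y\<close> to \<open>Y E\<close> and extends holomorphically to
  complex \<open>s\<close>. Moving \<open>s\<close> in the imaginary direction multiplies \<open>G s\<close> by unitary diagonal matrices on
  both sides and so does not change its norm. A holomorphic function is harmonic, so \<open>G s\<close> agrees up to
  \<open>o(h\<^sup>2)\<close> with the mean of its values at \<open>s \<plusminus> h\<close> and \<open>s \<plusminus> \<i> h\<close>; taking norms,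
  \<open>2 N (G s) \<le> N (G (s + h)) + N (G (s - h)) + o(h\<^sup>2)\<close> (\<open>interpolant_second_difference\<close>). A
  continuous function with this property lies below its chord (\<open>chord_bound\<close>), which gives the
  arithmetic bound \<open>N (G \<nu>) \<le> (1 - \<nu>) a + \<nu> b\<close>. Rescaling \<open>D\<close> and \<open>E\<close> so that both ends have norm one
  turns it into the geometric bound.

  Scalars. Put \<open>n = N (A\<^sup>1\<^sup>-\<^sup>\<nu> X B\<^sup>\<nu>)\<close>, \<open>p = (1 - \<nu>) a + \<nu> b\<close>, \<open>q = \<nu> (a + b)\<close>, and let \<open>s\<close> be the quantity
  whose \<open>m\<close>-th power is subtracted. For \<open>m = 1\<close> the claim is \<open>n + q \<le> p + s\<close>, which follows from
  the bound on \<open>n\<close> by the refined Young inequality for \<open>a\<close> and \<open>\<surd>(a b)\<close> with weights \<open>1 - 2 \<nu>\<close> and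
  \<open>2 \<nu>\<close> (\<open>refined_young_shifted\<close>). As
  also \<open>n \<le> p\<close> and \<open>q \<le> p\<close>, the pair \<open>(p, s)\<close> is at least as spread out as \<open>(n, q)\<close>, and the inequality
  passes to \<open>m\<close>-th powers (\<open>power_sum_le\<close>).
\<close>

section \<open>Diagonalization of Hermitian matrices\<close>

text \<open>
  A maximizer of the Rayleigh quotient on the invariant subspace is an eigenvector: the first variation
  at \<open>v\<close> in the direction \<open>w = f v - l v\<close>, which stays in the subspace, is \<open>2 (w \<bullet> w)\<close>.
\<close>

lemma symmetric_eigenvector:
  fixes f :: "'a::euclidean_space \<Rightarrow> 'a"
  assumes lin: "linear f" and sym: "\<And>x y. f x \<bullet> y = x \<bullet> f y"
    and W: "subspace W" and inv: "\<And>x. x \<in> W \<Longrightarrow> f x \<in> W"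
    and ne: "x \<in> W" "x \<noteq> 0"
  obtains v l where "v \<in> W" "norm v = 1" "f v = l *\<^sub>R v"
proof -
  have "compact (W \<inter> sphere 0 1)" by (simp add: W closed_Int_compact closed_subspace)
  moreover have "x /\<^sub>R norm x \<in> W \<inter> sphere 0 1" using ne W by (simp add: subspace_mul)
  moreover have "continuous_on (W \<inter> sphere 0 1) (\<lambda>x. x \<bullet> f x)"
    by (intro continuous_intros linear_continuous_on linear_conv_bounded_linear[THEN iffD1] lin)
  ultimately obtain v where v: "v \<in> W \<inter> sphere 0 1"
    and vmax: "\<And>y. y \<in> W \<inter> sphere 0 1 \<Longrightarrow> y \<bullet> f y \<le> v \<bullet> f v"
    using continuous_attains_sup[of "W \<inter> sphere 0 1" "\<lambda>x. x \<bullet> f x"] by blast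
  define l where "l = v \<bullet> f v"
  have q: "y \<bullet> f y \<le> l * (y \<bullet> y)" if "y \<in> W" for y
  proof (cases "y = 0")
    case False
    have "y /\<^sub>R norm y \<in> W \<inter> sphere 0 1" using that False W by (simp add: subspace_mul)
    from vmax[OF this] have "(y \<bullet> f y) / (norm y)\<^sup>2 \<le> l"
      by (simp add: l_def linear_scale[OF lin] power2_eq_square divide_inverse mult_ac)
    with False show ?thesis by (simp add: divide_le_eq power2_norm_eq_inner)
  qed (simp add: linear_0[OF lin])
  define w where "w = f v - l *\<^sub>R v"
  have wW: "w \<in> W" using v W inv by (simp add: w_def subspace_diff subspace_mul)
  have "w \<bullet> w \<le> 0"
  proof (rule ccontr)
    assume "\<not> ?thesis"
    then have pos: "w \<bullet> w > 0" by linarith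
    define C where "C = l * (w \<bullet> w) - w \<bullet> f w"
    have C0: "C \<ge> 0" using q[OF wW] by (simp add: C_def)
    \<comment> \<open>From \<open>v\<close> to \<open>v + t w\<close> the form \<open>y \<bullet> f y - l (y \<bullet> y)\<close> grows from \<open>0\<close> by
      \<open>2 t (w \<bullet> w) - t\<^sup>2 C\<close>, which is positive for this \<open>t\<close>.\<close>
    define t where "t = (w \<bullet> w) / (C + 1)"
    have t: "t > 0" using pos C0 by (simp add: t_def)
    have "v + t *\<^sub>R w \<in> W" using v wW W by (simp add: subspace_add subspace_mul)
    from q[OF this] have "2 * t * (w \<bullet> f v - l * (w \<bullet> v)) \<le> t * t * C"
      using v sym[of v w]
      by (simp add: linear_add[OF lin] linear_scale[OF lin] inner_add_left inner_add_right C_def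
          l_def algebra_simps inner_commute norm_eq_1)
    moreover have "w \<bullet> f v - l * (w \<bullet> v) = w \<bullet> w"
      by (subst (3) w_def) (simp add: inner_diff_right)
    ultimately have "2 * (w \<bullet> w) \<le> t * C" using t by (simp add: mult.assoc)
    also have "t * C \<le> w \<bullet> w" using pos C0 by (simp add: t_def field_simps)
    finally show False using pos by simp
  qed
  then have "w = 0" by (metis inner_eq_zero_iff inner_ge_zero order_antisym)
  with v show ?thesis by (intro that[of v l]) (auto simp: w_def)
qed

definition cinner :: "complex^'n \<Rightarrow> complex^'n \<Rightarrow> complex" where
  "cinner x y = (\<Sum>i\<in>UNIV. cnj (x $ i) * y $ i)"

text \<open>
  The complex inner product is determined by the real one, so complex orthogonality to \<open>x\<close> is real
  orthogonality to \<open>x\<close> and \<open>\<i> x\<close>. This makes the real theory of Euclidean spaces applicable.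
\<close>

lemma Re_cinner: "Re (cinner x y) = x \<bullet> y"
  by (simp add: cinner_def inner_vec_def inner_complex_def)

lemma Im_cinner: "Im (cinner x y) = (\<i> *s x) \<bullet> y"
  by (simp add: cinner_def inner_vec_def inner_complex_def)

lemma cinner_commute: "cinner x y = cnj (cinner y x)"
  by (simp add: cinner_def mult.commute)

lemma hermitian_inner:
  assumes "conj_transpose A = A"
  shows "(A *v x) \<bullet> y = x \<bullet> (A *v y)"
proof -
  have A: "cnj (A $ i $ j) = A $ j $ i" for i j
  proof -
    have "cnj (A $ i $ j) = conj_transpose A $ j $ i"
      by (simp add: conj_transpose_def map_matrix_def transpose_def)
    then show ?thesis by (simp add: assms)
  qed
  have "cinner (A *v x) y = (\<Sum>i\<in>UNIV. \<Sum>j\<in>UNIV. cnj (x $ j) * (A $ j $ i * y $ i))"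
    by (simp add: cinner_def matrix_vector_mult_def sum_distrib_right A)
      (simp add: sum_distrib_left mult_ac)
  also have "\<dots> = cinner x (A *v y)"
    by (subst sum.swap) (simp add: cinner_def matrix_vector_mult_def sum_distrib_left)
  finally have "cinner (A *v x) y = cinner x (A *v y)" .
  then show ?thesis by (simp flip: Re_cinner)
qed

text \<open>
  An orthonormal family of eigenvectors, indexed by a subset of the index type, is extended one index at
  a time: the orthogonal complement of the family is invariant under \<open>A\<close> and so contains a further
  eigenvector.
\<close>

lemma hermitian_diagonalization:
  fixes A :: "complex^'n^'n"
  assumes A: "conj_transpose A = A"
  obtains U d where "unitary_matrix U" "A = U ** diag_matrix d ** conj_transpose U"
proof -
  have "\<exists>u l. (\<forall>i\<in>I. A *v u i = l i *\<^sub>R u i) \<and>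
      (\<forall>i\<in>I. \<forall>j\<in>I. cinner (u i) (u j) = (if i = j then 1 else 0))" for I :: "'n set"
  proof (induction I rule: finite_induct[OF finite])
    case 1 then show ?case by simp
  next
    case (2 k I)
    then obtain u l where eig: "\<And>i. i \<in> I \<Longrightarrow> A *v u i = l i *\<^sub>R u i"
      and orth: "\<And>i j. i \<in> I \<Longrightarrow> j \<in> I \<Longrightarrow> cinner (u i) (u j) = (if i = j then 1 else 0)"
      by blast
    \<comment> \<open>These are at most \<open>2 |I|\<close> vectors in a space of real dimension \<open>2 n\<close> with \<open>|I| < n\<close>, so some
      nonzero vector is orthogonal to all of them.\<close>
    define S where "S = u ` I \<union> (\<lambda>i. \<i> *s u i) ` I"
    have "dim S \<le> card S" by (rule dim_le_card') (simp add: S_def)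
    also have "card S \<le> card I + card I"
      unfolding S_def by (intro order_trans[OF card_Un_le] add_mono card_image_le) auto
    also have "card I + card I < DIM(complex^'n)"
    proof -
      have "card I < CARD('n)"
        using \<open>k \<notin> I\<close> by (intro psubset_card_mono) auto
      then show ?thesis by simp
    qed
    finally obtain x where x: "x \<noteq> 0" "\<And>y. y \<in> span S \<Longrightarrow> orthogonal x y"
      using orthogonal_to_subspace_exists by blast
    define W where "W = {y. \<forall>z\<in>S. z \<bullet> y = 0}"
    have xW: "x \<in> W"
      using x span_base[of _ S] by (auto simp: W_def orthogonal_def inner_commute)
    have W: "subspace W"
      by (auto simp: W_def subspace_def inner_add_right)
    have eigS: "\<exists>c. A *v z = c *\<^sub>R z" if "z \<in> S" for z
    proof -
      have "A *v (\<i> *s u i) = l i *\<^sub>R (\<i> *s u i)" if "i \<in> I" for i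
        by (simp add: vector_scalar_commute eig[OF that])  (simp add: vec_eq_iff)
      with eig that show ?thesis unfolding S_def by blast
    qed
    have inv: "A *v y \<in> W" if "y \<in> W" for y
      unfolding W_def
    proof safe
      fix z assume z: "z \<in> S"
      then obtain c where "A *v z = c *\<^sub>R z" using eigS by blast
      then have "z \<bullet> (A *v y) = c * (z \<bullet> y)" by (simp flip: hermitian_inner[OF A])
      then show "z \<bullet> (A *v y) = 0" using z that by (simp add: W_def)
    qed
    obtain v c where v: "v \<in> W" "norm v = 1" "A *v v = c *\<^sub>R v"
      using symmetric_eigenvector[of "(*v) A", OF _ hermitian_inner[OF A] W inv xW x(1)]
      by (metis matrix_vector_mul_linear)
    have vu: "cinner (u i) v = 0" if "i \<in> I" for i
      using v(1) that by (simp add: W_def S_def complex_eq_iff Re_cinner Im_cinner)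
    then have uv: "cinner v (u i) = 0" if "i \<in> I" for i
      using that by (subst cinner_commute) simp
    have vv: "cinner v v = 1"
      using v(2) cinner_commute[of v v] by (simp add: complex_eq_iff Re_cinner norm_eq_1)
    show ?case
      using 2 eig orth v vu uv vv
      by (intro exI[of _ "u(k := v)"] exI[of _ "l(k := c)"]) auto
  qed
  from this[of UNIV] obtain u :: "'n \<Rightarrow> complex^'n" and l
    where eig: "\<And>i. A *v u i = l i *\<^sub>R u i"
      and orth: "\<And>i j. cinner (u i) (u j) = (if i = j then 1 else 0)" by auto
  define U :: "complex^'n^'n" where "U = (\<chi> i j. u j $ i)"
  have UU: "conj_transpose U ** U = mat 1"
    using orth by (simp add: vec_eq_iff matrix_matrix_mult_def conj_transpose_def map_matrix_def
        transpose_def U_def mat_def cinner_def)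
  then have U: "unitary_matrix U"
    by (simp add: unitary_matrix_def matrix_left_right_inverse)
  have "(A ** U) $ i $ j = (U ** diag_matrix l) $ i $ j" for i j
  proof -
    have "(A ** U) $ i $ j = (A *v u j) $ i"
      by (simp add: U_def matrix_matrix_mult_def matrix_vector_mult_def)
    also have "\<dots> = u j $ i * complex_of_real (l j)"
      unfolding eig vector_scaleR_component by (simp add: scaleR_conv_of_real)
    also have "\<dots> = (U ** diag_matrix l) $ i $ j"
      by (simp add: diag_matrix_mult_right U_def)
    finally show ?thesis .
  qed
  then have "A ** U = U ** diag_matrix l" by (simp add: vec_eq_iff)
  then have "A = U ** diag_matrix l ** conj_transpose U"
    using U by (metis unitary_matrix_def matrix_mul_assoc matrix_mul_rid)
  with U show ?thesis by (rule that)
qed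

lemma positive_definite_diagonalization:
  fixes A :: "complex^'n^'n"
  assumes A: "positive_definite A"
  obtains U d where "unitary_matrix U" "A = U ** diag_matrix d ** conj_transpose U" "\<And>i. d i > 0"
proof -
  obtain U d where U: "unitary_matrix U" and AU: "A = U ** diag_matrix d ** conj_transpose U"
    using A hermitian_diagonalization unfolding positive_definite_def by blast
  have UU: "conj_transpose U ** U = mat 1" using U by (simp add: unitary_matrix_def)
  have "d i > 0" for i
  proof -
    define x where "x = U *v axis i 1"
    have cx: "conj_transpose U *v x = axis i 1"
      by (simp add: x_def matrix_vector_mul_assoc UU)
    then have x0: "x \<noteq> 0" by (auto simp: axis_eq_0_iff)
    have "A *v x = U *v (diag_matrix d *v axis i 1)"
      by (simp add: AU cx flip: matrix_vector_mul_assoc)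
    also have "diag_matrix d *v axis i 1 = d i *\<^sub>R axis i (1::complex)"
      by (simp add: vec_eq_iff matrix_vector_mult_def diag_matrix_def axis_def
          if_distrib[of "\<lambda>x. _ * x"] if_distrib[of "\<lambda>x. x * _"] of_real_def cong: if_cong)
    also have "U *v \<dots> = d i *\<^sub>R x"
      by (simp add: x_def linear_scale[OF matrix_vector_mul_linear])
    finally have "A *v x = d i *\<^sub>R x" .
    moreover have "0 < x \<bullet> (A *v x)"
      using A x0 by (simp add: positive_definite_def flip: Re_cinner cinner_def)
    ultimately show ?thesis
      using inner_ge_zero[of x] by (simp add: zero_less_mult_iff) 
  qed
  with U AU show ?thesis by (rule that)
qed

section \<open>Approximate midpoint convexity\<close>

text \<open>
  The classical maximum principle for convex functions. If \<open>g\<close> exceeded its chord, then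
  \<open>g - chord + \<epsilon> s\<^sup>2\<close> with small \<open>\<epsilon>\<close> would have an interior maximum, where the second difference of
  \<open>g\<close> is at most \<open>- 2 \<epsilon> h\<^sup>2\<close>.
\<close>

lemma chord_bound:
  fixes g :: "real \<Rightarrow> real"
  assumes cont: "continuous_on {0..1} g"
    and sd: "\<And>s \<epsilon>. \<lbrakk>0 < s; s < 1; 0 < \<epsilon>\<rbrakk> \<Longrightarrow>
      \<forall>\<^sub>F h in at_right 0. 2 * g s \<le> g (s + h) + g (s - h) + \<epsilon> * h\<^sup>2"
    and t: "0 \<le> t" "t \<le> 1"
  shows "g t \<le> (1 - t) * g 0 + t * g 1"
proof (rule ccontr)
  define L where "L = (\<lambda>s. (1 - s) * g 0 + s * g 1)"
  assume "\<not> ?thesis"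
  then have gt: "g t > L t" by (simp add: L_def)
  \<comment> \<open>Half the gap, so that the perturbed function still exceeds its boundary values \<open>0\<close> and \<open>\<epsilon>\<close> at \<open>t\<close>.\<close>
  define \<epsilon> where "\<epsilon> = (g t - L t) / 2"
  have \<epsilon>: "\<epsilon> > 0" using gt by (simp add: \<epsilon>_def)
  define \<psi> where "\<psi> = (\<lambda>s. g s - L s + \<epsilon> * s\<^sup>2)"
  have "continuous_on {0..1} \<psi>"
    unfolding \<psi>_def L_def by (intro continuous_intros cont)
  then obtain s where s: "s \<in> {0..1}" and smax: "\<And>y. y \<in> {0..1} \<Longrightarrow> \<psi> y \<le> \<psi> s"
    using continuous_attains_sup[of "{0..1::real}" \<psi>] by auto
  have "\<psi> s \<ge> \<psi> t" using smax t by simp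
  moreover have "\<psi> t > \<epsilon>"
    using gt \<epsilon> by (simp add: \<psi>_def \<epsilon>_def)
      (smt (verit) zero_le_power2 mult_nonneg_nonneg divide_nonneg_nonneg field_sum_of_halves)
  ultimately have "\<psi> s > \<epsilon>" by linarith
  moreover have "\<psi> 0 = 0" "\<psi> 1 = \<epsilon>" by (auto simp: \<psi>_def L_def)
  ultimately have "s \<noteq> 0" "s \<noteq> 1" using \<epsilon> by auto
  then have s01: "0 < s" "s < 1" using s by auto
  have "\<forall>\<^sub>F h in at_right 0. 0 < h \<and> h < s \<and> h < 1 - s"
    using s01 by (intro eventually_conj eventually_at_right_less)
      (auto simp: eventually_at_right_field intro: exI[of _ s] exI[of _ "1-s"])
  with sd[OF s01 \<epsilon>] have "\<forall>\<^sub>F h in at_right 0. (0 < h \<and> h < s \<and> h < 1 - s) \<and>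
      2 * g s \<le> g (s + h) + g (s - h) + \<epsilon> * h\<^sup>2"
    by eventually_elim simp
  then obtain h where h: "0 < h" "h < s" "h < 1 - s"
    and gh: "2 * g s \<le> g (s + h) + g (s - h) + \<epsilon> * h\<^sup>2"
    using eventually_happens' trivial_limit_at_right_real by blast
  have "\<psi> (s + h) \<le> \<psi> s" "\<psi> (s - h) \<le> \<psi> s" using h s01 by (auto intro!: smax)
  then have "g (s + h) + g (s - h) + 2 * (\<epsilon> * h\<^sup>2) \<le> 2 * g s"
    by (simp add: \<psi>_def L_def algebra_simps power2_eq_square)
  moreover have "\<epsilon> * h\<^sup>2 > 0" using \<epsilon> h by simp
  ultimately show False using gh by linarith
qed

section \<open>Unitarily invariant norms\<close>

lemma scaleR_matrix: "t *\<^sub>R (S :: complex^'n^'n) = map_matrix (\<lambda>z. complex_of_real t * z) S"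
  by (simp add: vec_eq_iff map_matrix_def of_real_def)

lemma
  assumes N: "matrix_norm N"
  shows matrix_norm_scaleR: "N (t *\<^sub>R S) = \<bar>t\<bar> * N S"
    and matrix_norm_triangle: "N (S + T) \<le> N S + N T"
    and matrix_norm_nonneg: "0 \<le> N S"
    and matrix_norm_eq_0: "N S = 0 \<longleftrightarrow> S = 0"
  using N unfolding matrix_norm_def scaleR_matrix by (auto simp: norm_of_real)

lemma matrix_norm_continuous:
  fixes N :: "complex^'n^'n \<Rightarrow> real"
  assumes N: "matrix_norm N"
  shows "continuous_on UNIV N"
proof (rule convex_on_continuous[OF open_UNIV])
  show "convex_on UNIV N"
  proof (rule convex_onI)
    fix t :: real and S T assume "0 < t" "t < 1"
    then show "N ((1 - t) *\<^sub>R S + t *\<^sub>R T) \<le> (1 - t) * N S + t * N T"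
      using matrix_norm_triangle[OF N, of "(1 - t) *\<^sub>R S" "t *\<^sub>R T"]
      by (simp add: matrix_norm_scaleR[OF N])
  qed simp
qed

text \<open>The factors \<open>p\<close> and \<open>q\<close> are the diagonals of unitary matrices multiplied from the left and the right.\<close>

lemma unitarily_invariant_phases:
  fixes N :: "complex^'n^'n \<Rightarrow> real"
  assumes N: "unitarily_invariant_norm N" and "\<And>i. cmod (p i) = 1" "\<And>j. cmod (q j) = 1"
  shows "N (\<chi> i j. p i * M $ i $ j * q j) = N M"
proof -
  define D where "D = (\<lambda>p. \<chi> i j. if i = j then p i else 0 :: complex^'n^'n)"
  have "unitary_matrix (D p)" if "\<And>i. cmod (p i) = 1" for p
  proof -
    have "conj_transpose (D p) ** D p = mat 1"
      using that by (auto simp: vec_eq_iff D_def conj_transpose_def map_matrix_def transpose_def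
          matrix_matrix_mult_def mat_def if_distrib[of "\<lambda>x. x * _"] complex_norm_square[symmetric]
          mult.commute[of "cnj _"] cong: if_cong)
    then show ?thesis by (simp add: unitary_matrix_def matrix_left_right_inverse)
  qed
  then have "N (D p ** M ** D q) = N M"
    using assms unfolding unitarily_invariant_norm_def by blast
  moreover have "D p ** M ** D q = (\<chi> i j. p i * M $ i $ j * q j)"
    by (simp add: vec_eq_iff D_def matrix_matrix_mult_def if_distrib[of "\<lambda>x. x * _"]
        if_distrib[of "\<lambda>x. _ * x"] cong: if_cong)
  ultimately show ?thesis by simp
qed

section \<open>Interpolation between two weighted matrices\<close>

definition interpolant :: "complex^'n^'n \<Rightarrow> ('n \<Rightarrow> real) \<Rightarrow> ('n \<Rightarrow> real) \<Rightarrow> real \<Rightarrow> complex^'n^'n" where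
  "interpolant Y d e s = diag_matrix (\<lambda>i. d i powr (1 - s)) ** Y ** diag_matrix (\<lambda>j. e j powr s)"

lemma interpolant_nth:
  assumes "\<And>i. d i > 0" "\<And>j. e j > 0"
  shows "interpolant Y d e s $ i $ j
    = complex_of_real (d i * exp (s * (ln (e j) - ln (d i)))) * Y $ i $ j"
proof -
  have "d i powr (1 - s) * e j powr s = d i * exp (s * (ln (e j) - ln (d i)))"
    using assms[of i] assms(2)[of j]
    by (simp add: powr_def algebra_simps exp_diff exp_add exp_minus field_simps)
  then show ?thesis
    by (simp add: interpolant_def diag_matrix_mult_left diag_matrix_mult_right mult_ac flip: of_real_mult)
qed

text \<open>
  The mean of \<open>exp (z w)\<close> over \<open>z = h, - h, \<i> h, - \<i> h\<close> is \<open>(cosh (h w) + cos (h w)) / 2\<close>. The quadratic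
  terms of \<open>cosh\<close> and \<open>cos\<close> cancel, so it differs from \<open>1\<close> by \<open>o(h\<^sup>2)\<close>.
\<close>

lemma cosh_cos_second_order:
  "((\<lambda>h::real. (2 - cosh (h * w) - cos (h * w)) / h\<^sup>2) \<longlongrightarrow> 0) (at_right 0)"
proof -
  have "((\<lambda>h::real. (2 - (exp (h * w) + exp (- (h * w)))/2 - cos (h * w)) / h\<^sup>2) \<longlongrightarrow> 0) (at_right 0)"
    by real_asymp
  then show ?thesis by (simp add: cosh_def)
qed

text \<open>
  Each entry of the path is a multiple of \<open>exp (s w)\<close>, so four times its value is nearly the sum of
  its values at \<open>s \<plusminus> h\<close> and of its holomorphic continuation at \<open>s \<plusminus> \<i> h\<close>. The latter two matrices have the norm of
  \<open>G s\<close>, hence half of \<open>4 N (G s)\<close> remains to be bounded by the real neighbours.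
\<close>

lemma interpolant_second_difference:
  fixes N :: "complex^'n^'n \<Rightarrow> real" and Y :: "complex^'n^'n"
  assumes N: "unitarily_invariant_norm N" and d: "\<And>i. d i > 0" and e: "\<And>j. e j > 0"
    and \<epsilon>: "\<epsilon> > 0"
  defines "G \<equiv> interpolant Y d e"
  shows "\<forall>\<^sub>F h in at_right 0. 2 * N (G s) \<le> N (G (s + h)) + N (G (s - h)) + \<epsilon> * h\<^sup>2"
proof -
  have mN: "matrix_norm N" using N by (simp add: unitarily_invariant_norm_def)
  define w where "w = (\<lambda>i j. ln (e j) - ln (d i))"
  \<comment> \<open>The continuation of the path to \<open>s + \<i> h\<close>.\<close>
  define P where
    "P = (\<lambda>h. \<chi> i j. cis (- (h * ln (d i))) * G s $ i $ j * cis (h * ln (e j)))"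
  \<comment> \<open>The error of the four-point sum, divided by \<open>2 h\<^sup>2\<close>.\<close>
  define K where
    "K = (\<lambda>h. \<chi> i j. complex_of_real ((2 - cosh (h * w i j) - cos (h * w i j)) / h\<^sup>2) * G s $ i $ j)"
  have P: "N (P h) = N (G s)" for h
    unfolding P_def by (rule unitarily_invariant_phases[OF N]) auto
  have split: "4 *\<^sub>R G s = G (s + h) + (G (s - h) + (P h + (P (- h) + (2 * h\<^sup>2) *\<^sub>R K h)))"
    if "h > 0" for h
  proof -
    have "4 * G s $ i $ j = G (s + h) $ i $ j + (G (s - h) $ i $ j + (P h $ i $ j
        + (P (- h) $ i $ j + (2 * h\<^sup>2) *\<^sub>R K h $ i $ j)))" for i j
    proof -
      have G: "G t $ i $ j = complex_of_real (d i * exp (t * w i j)) * Y $ i $ j" for t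
        by (simp add: G_def interpolant_nth[OF d e] w_def)
      have plus: "G (s + t) $ i $ j = complex_of_real (exp (t * w i j)) * G s $ i $ j" for t
        by (simp add: G distrib_right exp_add mult_ac)
      have minus: "G (s - h) $ i $ j = complex_of_real (exp (- (h * w i j))) * G s $ i $ j"
        using plus[of "- h"] by simp
      have "cis (t * w i j) = cis (- (t * ln (d i))) * cis (t * ln (e j))" for t
        by (simp add: cis_mult w_def right_diff_distrib)
      then have ph: "P t $ i $ j = cis (t * w i j) * G s $ i $ j" for t
        by (simp add: P_def mult_ac)
      have cs: "cis (h * w i j) + cis (- h * w i j) = complex_of_real (2 * cos (h * w i j))"
        by (simp add: complex_eq_iff)
      have ch: "exp (h * w i j) + exp (- (h * w i j)) = 2 * cosh (h * w i j)"
        by (simp add: cosh_def)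
      have kk: "(2 * h\<^sup>2) *\<^sub>R K h $ i $ j
        = complex_of_real (2 * (2 - cosh (h * w i j) - cos (h * w i j))) * G s $ i $ j"
        using that by (simp add: K_def scaleR_conv_of_real)
      have "G (s + h) $ i $ j + (G (s - h) $ i $ j + (P h $ i $ j
        + (P (- h) $ i $ j + (2 * h\<^sup>2) *\<^sub>R K h $ i $ j)))
        = (complex_of_real (exp (h * w i j) + exp (- (h * w i j)))
          + (cis (h * w i j) + cis (- h * w i j))
          + complex_of_real (2 * (2 - cosh (h * w i j) - cos (h * w i j)))) * G s $ i $ j"
        unfolding plus minus ph kk by (simp add: algebra_simps)
      also have "\<dots> = 4 * G s $ i $ j"
        unfolding cs ch by (simp add: algebra_simps)
      finally show ?thesis by simp
    qed
    then show ?thesis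
      unfolding vec_eq_iff vector_add_component vector_scaleR_component
      by (simp add: scaleR_conv_of_real)
  qed
  have "((\<lambda>h. complex_of_real ((2 - cosh (h * w i j) - cos (h * w i j)) / h\<^sup>2) * G s $ i $ j)
      \<longlongrightarrow> 0) (at_right 0)" for i j
    using tendsto_of_real[OF cosh_cos_second_order[of "w i j"], where 'a = complex]
    by (intro tendsto_mult_left_zero) (simp only: of_real_0)
  then have "(K \<longlongrightarrow> 0) (at_right 0)"
    unfolding K_def by (intro vec_tendstoI) simp
  then have "((\<lambda>h. N (K h)) \<longlongrightarrow> N 0) (at_right 0)"
    by (rule continuous_on_tendsto_compose[OF matrix_norm_continuous[OF mN]]) auto
  then have "((\<lambda>h. N (K h)) \<longlongrightarrow> 0) (at_right 0)"
    using matrix_norm_eq_0[OF mN] by metis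
  then have "\<forall>\<^sub>F h in at_right 0. N (K h) < \<epsilon> / 2"
    using \<epsilon> by (intro order_tendstoD(2)) auto
  moreover have "\<forall>\<^sub>F h::real in at_right 0. 0 < h" by (rule eventually_at_right_less)
  ultimately show ?thesis
  proof eventually_elim
    case (elim h)
    have "4 * N (G s) = N (4 *\<^sub>R G s)" by (simp add: matrix_norm_scaleR[OF mN])
    also have "\<dots> \<le> N (G (s + h)) + (N (G (s - h)) + (N (P h) + (N (P (- h)) + N ((2 * h\<^sup>2) *\<^sub>R K h))))"
      unfolding split[OF elim(2)]
      by (intro order_trans[OF matrix_norm_triangle[OF mN]] add_left_mono) simp
    also have "N ((2 * h\<^sup>2) *\<^sub>R K h) = 2 * h\<^sup>2 * N (K h)"
      by (simp add: matrix_norm_scaleR[OF mN])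
    finally have "2 * N (G s) \<le> N (G (s + h)) + N (G (s - h)) + 2 * h\<^sup>2 * N (K h)"
      by (simp add: P)
    moreover have "2 * h\<^sup>2 * N (K h) \<le> 2 * h\<^sup>2 * (\<epsilon> / 2)"
      using elim by (intro mult_left_mono) auto
    ultimately show ?case by (simp add: mult.commute)
  qed
qed

lemma diag_matrix_one: "diag_matrix (\<lambda>i. 1) = mat 1"
  by (simp add: vec_eq_iff diag_matrix_def mat_def)

lemma interpolant_endpoints:
  assumes "\<And>i. d i > 0" "\<And>j. e j > 0"
  shows "interpolant Y d e 0 = diag_matrix d ** Y" "interpolant Y d e 1 = Y ** diag_matrix e"
proof -
  have "d i \<noteq> 0" "e i \<noteq> 0" "0 \<le> d i" "0 \<le> e i" for i
    using assms(1)[of i] assms(2)[of i] by auto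
  then show "interpolant Y d e 0 = diag_matrix d ** Y" "interpolant Y d e 1 = Y ** diag_matrix e"
    by (simp_all add: interpolant_def diag_matrix_one)
qed

lemma interpolant_arithmetic_bound:
  fixes N :: "complex^'n^'n \<Rightarrow> real"
  assumes N: "unitarily_invariant_norm N" and d: "\<And>i. d i > 0" and e: "\<And>j. e j > 0"
    and t: "0 \<le> t" "t \<le> 1"
  shows "N (interpolant Y d e t) \<le> (1 - t) * N (diag_matrix d ** Y) + t * N (Y ** diag_matrix e)"
proof -
  have mN: "matrix_norm N" using N by (simp add: unitarily_invariant_norm_def)
  have "interpolant Y d e = (\<lambda>s. \<chi> i j. complex_of_real (d i * exp (s * (ln (e j) - ln (d i)))) * Y $ i $ j)"
    by (simp add: fun_eq_iff vec_eq_iff interpolant_nth[OF d e])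
  then have "continuous_on {0..1} (interpolant Y d e)"
    by (simp only:) (intro continuous_intros)
  then have "continuous_on {0..1} (\<lambda>s. N (interpolant Y d e s))"
    by (rule continuous_on_compose2[OF matrix_norm_continuous[OF mN]]) simp
  then have "N (interpolant Y d e t) \<le> (1 - t) * N (interpolant Y d e 0) + t * N (interpolant Y d e 1)"
    by (rule chord_bound[OF _ _ t]) (rule interpolant_second_difference[OF N d e])
  then show ?thesis by (simp only: interpolant_endpoints[OF d e])
qed

text \<open>
  The arithmetic bound is not homogeneous in \<open>d\<close> and \<open>e\<close> separately while the geometric one is, so it
  suffices to apply the former after normalizing the two end points.
\<close>

lemma interpolant_geometric_bound:
  fixes N :: "complex^'n^'n \<Rightarrow> real"
  assumes N: "unitarily_invariant_norm N" and d: "\<And>i. d i > 0" and e: "\<And>j. e j > 0"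
    and t: "0 \<le> t" "t \<le> 1"
  shows "N (interpolant Y d e t) \<le> N (diag_matrix d ** Y) powr (1 - t) * N (Y ** diag_matrix e) powr t"
proof (cases "Y = 0")
  case True
  have "N 0 = 0" using N by (simp add: unitarily_invariant_norm_def matrix_norm_def)
  with True show ?thesis by (simp add: interpolant_def)
next
  case False
  have mN: "matrix_norm N" using N by (simp add: unitarily_invariant_norm_def)
  define a b where "a = N (diag_matrix d ** Y)" and "b = N (Y ** diag_matrix e)"
  obtain i j where ij: "Y $ i $ j \<noteq> 0" using False by (auto simp: vec_eq_iff)
  have "diag_matrix d ** Y \<noteq> 0" "Y ** diag_matrix e \<noteq> 0"
    using ij d[of i] e[of j] diag_matrix_mult_left[of d Y i j] diag_matrix_mult_right[of Y e i j]
    by (metis less_irrefl mult_eq_0_iff of_real_eq_0_iff zero_index)+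
  then have ab: "a > 0" "b > 0"
    using matrix_norm_nonneg[OF mN] matrix_norm_eq_0[OF mN] unfolding a_def b_def
    by (metis less_eq_real_def)+
  define d' e' where "d' = (\<lambda>i. d i / a)" and "e' = (\<lambda>j. e j / b)"
  have d': "d' i > 0" and e': "e' i > 0" for i using d e ab by (auto simp: d'_def e'_def)
  have left: "diag_matrix d' ** Y = (1 / a) *\<^sub>R (diag_matrix d ** Y)"
    and right: "Y ** diag_matrix e' = (1 / b) *\<^sub>R (Y ** diag_matrix e)"
    unfolding vec_eq_iff vector_scaleR_component diag_matrix_mult_left diag_matrix_mult_right
    by (simp_all add: d'_def e'_def scaleR_conv_of_real field_simps)
  have mid: "interpolant Y d' e' t = (1 / (a powr (1 - t) * b powr t)) *\<^sub>R interpolant Y d e t"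
    unfolding interpolant_def vec_eq_iff vector_scaleR_component diag_matrix_mult_left diag_matrix_mult_right
    using d e ab by (simp add: d'_def e'_def scaleR_conv_of_real powr_divide less_imp_le)
  have "N (interpolant Y d' e' t) \<le> 1"
    using interpolant_arithmetic_bound[where d = d' and e = e' and Y = Y, OF N d' e' t] ab
    by (simp add: left right matrix_norm_scaleR[OF mN] flip: a_def b_def)
  then show ?thesis
    using ab by (simp add: mid matrix_norm_scaleR[OF mN] divide_le_eq mult_ac flip: a_def b_def)
qed

text \<open>
  The eigenvector bases of \<open>A\<close> and \<open>B\<close> are absorbed into \<open>X\<close>, leaving diagonal weights.
\<close>

lemma norm_powr_interpolation:
  fixes A B X :: "complex^'n^'n"
  assumes A: "positive_definite A" and B: "positive_definite B"
    and N: "unitarily_invariant_norm N" and t: "0 \<le> t" "t \<le> 1"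
  shows "N (matrix_powr A (1 - t) ** X ** matrix_powr B t)
    \<le> N (A ** X) powr (1 - t) * N (X ** B) powr t"
proof -
  obtain U d where U: "unitary_matrix U" and AU: "A = U ** diag_matrix d ** conj_transpose U"
    and d: "\<And>i. d i > 0" using positive_definite_diagonalization[OF A] by blast
  obtain V e where V: "unitary_matrix V" and BV: "B = V ** diag_matrix e ** conj_transpose V"
    and e: "\<And>i. e i > 0" using positive_definite_diagonalization[OF B] by blast
  have UU: "conj_transpose U ** U = mat 1" "U ** conj_transpose U = mat 1"
    and VV: "conj_transpose V ** V = mat 1" "V ** conj_transpose V = mat 1"
    using U V by (auto simp: unitary_matrix_def)
  have cV: "unitary_matrix (conj_transpose V)"
    using VV by (simp add: unitary_matrix_def) (simp add: conj_transpose_def map_matrix_def transpose_def)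
  have inv: "N (U ** M ** conj_transpose V) = N M" for M
    using N U cV unfolding unitarily_invariant_norm_def by blast
  define Y where "Y = conj_transpose U ** X ** V"
  have cancel: "conj_transpose U ** (U ** M) = M" "U ** (conj_transpose U ** M) = M"
    "conj_transpose V ** (V ** M) = M" "V ** (conj_transpose V ** M) = M" for M :: "complex^'n^'n"
    by (simp_all add: matrix_mul_assoc UU VV)
  have X: "X = U ** Y ** conj_transpose V"
    by (simp add: Y_def cancel VV flip: matrix_mul_assoc)
  have "A ** X = U ** (diag_matrix d ** Y) ** conj_transpose V"
    by (simp add: AU X cancel flip: matrix_mul_assoc)
  moreover have "X ** B = U ** (Y ** diag_matrix e) ** conj_transpose V"
    by (simp add: BV X cancel flip: matrix_mul_assoc)
  moreover have "matrix_powr A (1 - t) ** X ** matrix_powr B t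
      = U ** interpolant Y d e t ** conj_transpose V"
    unfolding matrix_powr_def spectral_calculus_eq[OF U AU] spectral_calculus_eq[OF V BV]
    by (simp add: interpolant_def X cancel flip: matrix_mul_assoc)
  ultimately show ?thesis
    using interpolant_geometric_bound[OF N d e t, of Y] by (simp add: inv)
qed

section \<open>Scalar inequalities\<close>

text \<open>
  With \<open>c = \<surd>(a b)\<close> and \<open>e = \<surd>(a c)\<close> the subtracted square is \<open>c + a - 2 e\<close>. Subtracting \<open>r\<close> times
  this from \<open>(1 - 2 \<nu>) a + 2 \<nu> c\<close> removes the term in \<open>c\<close> if \<open>\<nu> \<le> 1/4\<close> and the term in \<open>a\<close> otherwise, and
  leaves a convex combination of two numbers: of \<open>a\<close> and \<open>e\<close>, or of \<open>c\<close> and \<open>e\<close>. The weighted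
  arithmetic-geometric mean inequality for them has \<open>a\<^sup>1\<^sup>-\<^sup>\<nu> b\<^sup>\<nu>\<close> on its left-hand side.
\<close>

lemma refined_young_shifted:
  fixes a b n \<nu> :: real
  assumes a: "0 \<le> a" and b: "0 \<le> b" and n: "0 \<le> n" "n \<le> a powr (1 - \<nu>) * b powr \<nu>"
    and \<nu>: "0 < \<nu>" "\<nu> \<le> 1/2" and r: "r = min (2 * \<nu>) (1 - 2 * \<nu>)"
    shows "n + \<nu> * (a + b) \<le> (1 - \<nu>) * a + \<nu> * b
      + (2 * \<nu> * (a * b) powr (1/2) - r * ((a * b) powr (1/4) - a powr (1/2))\<^sup>2)"
proof (cases "a = 0 \<or> b = 0")
  case True
  have "r \<le> 1 - 2 * \<nu>" "r \<ge> 0" using r \<nu> by auto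
  then have "r * a \<le> (1 - 2 * \<nu>) * a" by (intro mult_right_mono a)
  with True n \<nu> a show ?thesis
    by (auto simp: algebra_simps powr_half_sqrt)
next
  case False
  then have pos: "a > 0" "b > 0" using a b by auto
  define c where "c = (a * b) powr (1/2)"
  define e where "e = a powr (3/4) * b powr (1/4)"
  have sq: "((a * b) powr (1/4) - a powr (1/2))\<^sup>2 = c + a - 2 * e"
    using pos by (simp add: power2_diff powr_mult c_def e_def power_mult_distrib
       flip: powr_add) (simp add: power2_eq_square flip: powr_add mult.assoc)
  have "a powr (1 - \<nu>) * b powr \<nu> \<le> (1 - 2 * \<nu>) * a + 2 * \<nu> * c - r * (c + a - 2 * e)"
  proof (cases "\<nu> \<le> 1/4")
    case True
    then have r2: "r = 2 * \<nu>" using r by simp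
    have "a powr (1 - \<nu>) * b powr \<nu> = a powr (1 - 4 * \<nu>) * e powr (4 * \<nu>)"
      using pos by (simp add: e_def powr_mult powr_powr flip: powr_add mult.assoc)
    also have "\<dots> \<le> (1 - 4 * \<nu>) * a + (4 * \<nu>) * e"
      using pos True \<nu> by (intro Youngs_inequality_0) (auto simp: e_def)
    finally show ?thesis by (simp add: r2 algebra_simps)
  next
    case False
    then have r2: "r = 1 - 2 * \<nu>" using r by simp
    have "c powr (4 * \<nu> - 1) * e powr (2 - 4 * \<nu>)
        = (a powr ((4 * \<nu> - 1) / 2) * a powr (3 * (2 - 4 * \<nu>) / 4))
          * (b powr ((4 * \<nu> - 1) / 2) * b powr ((2 - 4 * \<nu>) / 4))"
      using pos by (simp add: c_def e_def powr_mult powr_powr mult_ac)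
    also have "\<dots> = a powr (1 - \<nu>) * b powr \<nu>"
    proof -
      have "(4 * \<nu> - 1) / 2 + 3 * (2 - 4 * \<nu>) / 4 = 1 - \<nu>"
        "(4 * \<nu> - 1) / 2 + (2 - 4 * \<nu>) / 4 = \<nu>" by (simp_all add: field_simps)
      then show ?thesis by (simp flip: powr_add)
    qed
    finally have "a powr (1 - \<nu>) * b powr \<nu> = c powr (4 * \<nu> - 1) * e powr (2 - 4 * \<nu>)" ..
    also have "\<dots> \<le> (4 * \<nu> - 1) * c + (2 - 4 * \<nu>) * e"
      using pos False \<nu> by (intro Youngs_inequality_0) (auto simp: e_def c_def)
    finally show ?thesis by (simp add: r2 algebra_simps)
  qed
  with n show ?thesis unfolding sq c_def[symmetric] by (simp add: algebra_simps)
qed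

lemma power_superadditive:
  fixes x y :: real
  assumes "0 \<le> x" "0 \<le> y" "0 < m"
  shows "x ^ m + y ^ m \<le> (x + y) ^ m"
proof -
  obtain k where k: "m = Suc k" using assms gr0_implies_Suc by blast
  have "x * x ^ k \<le> x * (x + y) ^ k" "y * y ^ k \<le> y * (x + y) ^ k"
    using assms by (auto intro!: mult_left_mono power_mono)
  then show ?thesis by (simp add: k distrib_right)
qed

text \<open>
  For \<open>0 \<le> s\<close> this is the majorization inequality for the convex function \<open>x\<^sup>m\<close>. If \<open>s\<close> is negative, it
  is moved to the other side: \<open>p\<close> dominates the sum of the nonnegative numbers \<open>n\<close>, \<open>q\<close> and \<open>- s\<close>.
\<close>

lemma power_sum_le:
  fixes p q s n :: real
  assumes nonneg: "0 \<le> q" "0 \<le> n" and le: "q \<le> p" "n \<le> p" and sum: "n + q \<le> p + s"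
    and m: "0 < m"
  shows "n ^ m + q ^ m \<le> p ^ m + s ^ m"
proof (cases "s < 0")
  case True
  have "n ^ m + q ^ m + (-s) ^ m \<le> (n + q) ^ m + (-s) ^ m"
    using power_superadditive[OF nonneg(2,1) m] by simp
  also have "\<dots> \<le> (n + q + (-s)) ^ m"
    using nonneg True m by (intro power_superadditive) auto
  also have "\<dots> \<le> p ^ m"
    using nonneg True sum by (intro power_mono) auto
  finally have "n ^ m + q ^ m + (-s) ^ m \<le> p ^ m" .
  moreover have "- (s ^ m) \<le> (-s) ^ m"
    using True by (cases "even m") (auto simp: power_minus_odd)
  ultimately show ?thesis by linarith
next
  case False
  consider "n \<le> s" | "q \<le> s" | "s < n" "s < q" by linarith
  then show ?thesis
  proof cases
    case 1 then show ?thesis using nonneg le power_mono[of n s m] power_mono[of q p m] by linarith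
  next
    case 2 then show ?thesis using nonneg le power_mono[of q s m] power_mono[of n p m] by linarith
  next
    \<comment> \<open>Here \<open>s\<close> is the smallest of the four, so the difference quotient of \<open>x\<^sup>m\<close> is smaller on \<open>[s, q]\<close>
      than on \<open>[n, p]\<close>, and the former interval is not longer.\<close>
    case 3
    have "q ^ m - s ^ m = (q - s) * (\<Sum>i<m. s ^ (m - Suc i) * q ^ i)"
      by (rule power_diff_sumr2)
    also have "\<dots> \<le> (p - n) * (\<Sum>i<m. n ^ (m - Suc i) * p ^ i)"
      using 3 False nonneg le sum
      by (intro mult_mono sum_mono power_mono sum_nonneg) auto
    also have "\<dots> = p ^ m - n ^ m"
      by (rule power_diff_sumr2[symmetric])
    finally show ?thesis by linarith
  qed
qed

section \<open>The norm inequality\<close>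

theorem theorem3p6:
  fixes A B X :: "complex^'n^'n"
    and N :: "complex^'n^'n \<Rightarrow> real"
    and m :: nat and \<nu> r\<^sub>0 :: real
  assumes "positive_definite A" and "positive_definite B"
    and "unitarily_invariant_norm N"
    and "1 \<le> m"
    and "0 < \<nu>" and "\<nu> \<le> 1/2"
    and "r\<^sub>0 = min (2 * \<nu>) (1 - 2 * \<nu>)"
  shows "((1 - \<nu>) * N (A ** X) + \<nu> * N (X ** B)) ^ m
    \<ge> N (matrix_powr A (1 - \<nu>) ** X ** matrix_powr B \<nu>) ^ m
      + \<nu> ^ m * (N (A ** X) + N (X ** B)) ^ m
      - (2 * \<nu> * (N (A ** X) * N (X ** B)) powr (1/2)
         - r\<^sub>0 * ((N (A ** X) * N (X ** B)) powr (1/4) - N (A ** X) powr (1/2))\<^sup>2) ^ m"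
proof -
  have mN: "matrix_norm N" using assms(3) by (simp add: unitarily_invariant_norm_def)
  define a b n where "a = N (A ** X)" and "b = N (X ** B)"
    and "n = N (matrix_powr A (1 - \<nu>) ** X ** matrix_powr B \<nu>)"
  have nonneg: "0 \<le> a" "0 \<le> b" "0 \<le> n"
    using matrix_norm_nonneg[OF mN] by (auto simp: a_def b_def n_def)
  have n: "n \<le> a powr (1 - \<nu>) * b powr \<nu>"
    using norm_powr_interpolation[OF assms(1-3)] assms(5,6) by (simp add: a_def b_def n_def)
  have "a powr (1 - \<nu>) * b powr \<nu> \<le> (1 - \<nu>) * a + \<nu> * b"
  proof (cases "a = 0 \<or> b = 0")
    case False
    then show ?thesis using nonneg assms(5,6) by (intro Youngs_inequality_0) auto
  qed (use nonneg assms(5,6) in auto)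
  with n have np: "n \<le> (1 - \<nu>) * a + \<nu> * b" by simp
  have "\<nu> * a \<le> (1 - \<nu>) * a" using nonneg assms(6) by (intro mult_right_mono) auto
  then have qp: "\<nu> * (a + b) \<le> (1 - \<nu>) * a + \<nu> * b" by (simp add: distrib_left)
  have "n ^ m + (\<nu> * (a + b)) ^ m \<le> ((1 - \<nu>) * a + \<nu> * b) ^ m
      + (2 * \<nu> * (a * b) powr (1/2) - r\<^sub>0 * ((a * b) powr (1/4) - a powr (1/2))\<^sup>2) ^ m"
    using nonneg assms(4,5) qp np refined_young_shifted[OF nonneg n assms(5-7)]
    by (intro power_sum_le) auto
  then show ?thesis by (simp add: a_def b_def n_def power_mult_distrib)
qed

end
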